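(* Let $n\ge 1$ be an integer and let $(X,d)$ be a finite metric tree. If $X$ has at most $2n$ leaves, then $X$ can be embedded isometrically into $(\mathbb{R}^n,d_1)$.
   Context: Finite metric tree: take a finite connected graph without cycles (a finite tree in the sense of graph theory) whose edges carry positive real weights and which has no vertex of degree 2. The finite metric tree is the metric space consisting of all points of the geometric realization of this graph, where each edge is identified with a closed interval whose length is the weight of the edge. The distance between two vertices is the total weight of the unique simple path joining them, and the distance between two arbitrary points (possibly interior to edges) is the length of the unique simple path joining them, taking into account the corresponding portions of the edges carrying these points. A leaf is a vertex of degree 1. The metric $d_1$ on $\mathbb{R}^n$ is $d_1(x,y)=\sum_{i=1}^n|x_i-y_i|$. An isometric embedding is a distance-preserving map (not necessarily surjective) defined on the whole metric tree (all points, not only vertices). *)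

theory Defs
  imports "HOL-Analysis.Analysis"
begin

text \<open>A finite simple graph is given by its vertex set \<open>V\<close> and its set \<open>E\<close> of edges, each edge
  being a two-element set of vertices.\<close>

definition finite_simple_graph :: "'a set \<Rightarrow> 'a set set \<Rightarrow> bool" where
  "finite_simple_graph V E \<longleftrightarrow> finite V \<and> (\<forall>e\<in>E. e \<subseteq> V \<and> card e = 2)"

definition adjacent :: "'a set set \<Rightarrow> 'a \<Rightarrow> 'a \<Rightarrow> bool" where
  "adjacent E u v \<longleftrightarrow> {u, v} \<in> E"

definition connected_graph :: "'a set \<Rightarrow> 'a set set \<Rightarrow> bool" where
  "connected_graph V E \<longleftrightarrow> V \<noteq> {} \<and>
     (\<forall>u\<in>V. \<forall>v\<in>V. \<exists>vs. vs \<noteq> [] \<and> hd vs = u \<and> last vs = v \<and> successively (adjacent E) vs)"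

text \<open>A cycle is listed without repeating its initial vertex; the bound on the length keeps an
  edge traversed back and forth from being a cycle.\<close>

definition graph_cycle :: "'a set set \<Rightarrow> 'a list \<Rightarrow> bool" where
  "graph_cycle E vs \<longleftrightarrow> length vs \<ge> 3 \<and> distinct vs \<and> successively (adjacent E) vs \<and>
     adjacent E (last vs) (hd vs)"

definition finite_tree :: "'a set \<Rightarrow> 'a set set \<Rightarrow> bool" where
  "finite_tree V E \<longleftrightarrow> finite_simple_graph V E \<and> connected_graph V E \<and> (\<nexists>vs. graph_cycle E vs)"

definition vertex_degree :: "'a set set \<Rightarrow> 'a \<Rightarrow> nat" where
  "vertex_degree E v = card {e\<in>E. v \<in> e}"

definition leaves :: "'a set \<Rightarrow> 'a set set \<Rightarrow> 'a set" where
  "leaves V E = {v\<in>V. vertex_degree E v = 1}"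

definition metric_tree_data :: "'a set \<Rightarrow> 'a set set \<Rightarrow> ('a set \<Rightarrow> real) \<Rightarrow> bool" where
  "metric_tree_data V E w \<longleftrightarrow>
     finite_tree V E \<and> (\<forall>e\<in>E. w e > 0) \<and> (\<forall>v\<in>V. vertex_degree E v \<noteq> 2)"

text \<open>Points of the geometric realization are given by barycentric coordinates. The vertex \<open>v\<close> is
  the function that is 1 at \<open>v\<close> and 0 elsewhere; the point of the edge \<open>{u, v}\<close> at distance \<open>s\<close>
  from \<open>u\<close> is the function with value \<open>1 - s / w {u, v}\<close> at \<open>u\<close>, \<open>s / w {u, v}\<close> at \<open>v\<close>, and 0
  elsewhere. In this way edges meet in common end points only.\<close>

definition cell :: "'a set \<Rightarrow> ('a \<Rightarrow> real) set" where
  "cell s = {p. (\<forall>v. 0 \<le> p v) \<and> (\<forall>v. v \<notin> s \<longrightarrow> p v = 0) \<and> (\<Sum>v\<in>s. p v) = 1}"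

definition tree_points :: "'a set \<Rightarrow> 'a set set \<Rightarrow> ('a \<Rightarrow> real) set" where
  "tree_points V E = (\<Union>v\<in>V. cell {v}) \<union> (\<Union>e\<in>E. cell e)"

definition straight_segment :: "('a \<Rightarrow> real) \<Rightarrow> ('a \<Rightarrow> real) \<Rightarrow> ('a \<Rightarrow> real) set" where
  "straight_segment p q = {\<lambda>v. (1 - t) * p v + t * q v |t. 0 \<le> t \<and> t \<le> 1}"

text \<open>For \<open>p\<close> and \<open>q\<close> on the edge \<open>e\<close>, the two end points of \<open>e\<close> contribute the same amount
  to the sum, namely the fraction of \<open>e\<close> that lies between \<open>p\<close> and \<open>q\<close>.\<close>

definition segment_length ::
    "('a set \<Rightarrow> real) \<Rightarrow> 'a set \<Rightarrow> ('a \<Rightarrow> real) \<Rightarrow> ('a \<Rightarrow> real) \<Rightarrow> real" where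
  "segment_length w e p q = w e * ((\<Sum>v\<in>e. \<bar>p v - q v\<bar>) / 2)"

text \<open>A path consists of nondegenerate segments from \<open>ps ! i\<close> to \<open>ps ! Suc i\<close>, each contained in
  the edge \<open>es ! i\<close>. It is simple: consecutive segments share only the point where they are
  joined, and other pairs of segments are disjoint. A single point is a path without segments.\<close>

definition simple_path_between :: "'a set \<Rightarrow> 'a set set \<Rightarrow> ('a \<Rightarrow> real) \<Rightarrow> ('a \<Rightarrow> real) \<Rightarrow>
    ('a \<Rightarrow> real) list \<Rightarrow> 'a set list \<Rightarrow> bool" where
  "simple_path_between V E x y ps es \<longleftrightarrow>
     length ps = Suc (length es) \<and> hd ps = x \<and> last ps = y \<and> set ps \<subseteq> tree_points V E \<and>
     (\<forall>i<length es. es ! i \<in> E \<and> ps ! i \<in> cell (es ! i) \<and> ps ! Suc i \<in> cell (es ! i) \<and>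
        ps ! i \<noteq> ps ! Suc i) \<and>
     (\<forall>j<length es. \<forall>i<j.
        straight_segment (ps ! i) (ps ! Suc i) \<inter> straight_segment (ps ! j) (ps ! Suc j) =
          (if j = Suc i then {ps ! j} else {}))"

definition path_length :: "('a set \<Rightarrow> real) \<Rightarrow> ('a \<Rightarrow> real) list \<Rightarrow> 'a set list \<Rightarrow> real" where
  "path_length w ps es = (\<Sum>i<length es. segment_length w (es ! i) (ps ! i) (ps ! Suc i))"

text \<open>Subdividing the segments of a path changes the lists \<open>ps\<close> and \<open>es\<close>, but neither the set of
  points traversed nor the length; so it is the length that is unique.\<close>

definition tree_dist :: "'a set \<Rightarrow> 'a set set \<Rightarrow> ('a set \<Rightarrow> real) \<Rightarrow>
    ('a \<Rightarrow> real) \<Rightarrow> ('a \<Rightarrow> real) \<Rightarrow> real" where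
  "tree_dist V E w x y =
     (THE l. \<exists>ps es. simple_path_between V E x y ps es \<and> l = path_length w ps es)"

definition d1 :: "real ^ 'n \<Rightarrow> real ^ 'n \<Rightarrow> real" where
  "d1 x y = (\<Sum>i\<in>UNIV. \<bar>x $ i - y $ i\<bar>)"

definition isometric_embedding ::
    "'p set \<Rightarrow> ('p \<Rightarrow> 'p \<Rightarrow> real) \<Rightarrow> ('q \<Rightarrow> 'q \<Rightarrow> real) \<Rightarrow> ('p \<Rightarrow> 'q) \<Rightarrow> bool" where
  "isometric_embedding X d d' f \<longleftrightarrow> (\<forall>x\<in>X. \<forall>y\<in>X. d' (f x) (f y) = d x y)"

end

theory Submission
  imports Defs
begin

text \<open>Deleting an edge \<open>e\<close> cuts a tree into two branches. Since points are given by barycentric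
  coordinates, the mass \<open>c e p\<close> that a point \<open>p\<close> puts on the vertices of one fixed branch is a
  linear coordinate: it is constant, equal to 0 or 1, on every other edge, and on \<open>e\<close> it runs from 0 to
  1 proportionally to arc length. A simple path cannot turn back on an edge, so \<open>c e\<close> is monotone
  along it, and its length is therefore \<open>\<Sum>e\<in>E. w e * \<bar>c e y - c e x\<bar>\<close>. This depends on the end
  points only; together with the existence of a simple path it evaluates the distance
  (\<open>tree_dist_cuts\<close>).

  Thus it suffices to distribute the edges over the \<open>n\<close> coordinate axes such that, for the edges
  \<open>e\<close> on one axis, the differences \<open>c e y - c e x\<close> never have opposite signs: the sum of the
  \<open>w e * c e\<close> over these edges is then a coordinate function that loses no length to
  cancellation. This works if all edges of the axis lie on the path from some vertex \<open>a\<close> to some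
  vertex \<open>b\<close>, the branches being those that contain \<open>b\<close>; for these branches form a chain under
  inclusion (\<open>cuts_same_direction\<close>).

  What remains is to cover the tree by \<open>n\<close> paths. Arrange the leaves, with repetitions if
  there are fewer than \<open>2 n\<close> of them, into \<open>n\<close> pairs such that the total number of edges
  separating the partners is as large as possible. If an edge \<open>e\<close> separated no pair, then there
  would be a pair on each side of \<open>e\<close>, because each branch contains a leaf; exchanging partners
  between the two pairs gains \<open>e\<close> twice, and it loses no other edge, because the two
  partitions of the vertices that are given by two edges of a tree do not cross
  (\<open>pairing_crossing_all_cuts\<close>).\<close>

section \<open>Sequences of real numbers that do not turn\<close>

lemma abs_sum_same_sign:
  fixes g :: "'b \<Rightarrow> real"
  assumes "\<And>i j. i \<in> A \<Longrightarrow> j \<in> A \<Longrightarrow> 0 \<le> g i * g j"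
  shows "\<bar>sum g A\<bar> = (\<Sum>i\<in>A. \<bar>g i\<bar>)"
proof (cases "\<exists>i\<in>A. g i < 0")
  case True
  then obtain i where i: "i \<in> A" "g i < 0" by blast
  have neg: "g j \<le> 0" if "j \<in> A" for j
    using assms[OF i(1) that] i(2) by (simp add: zero_le_mult_iff)
  have "(\<Sum>j\<in>A. \<bar>g j\<bar>) = (\<Sum>j\<in>A. - g j)"
    by (rule sum.cong) (use neg in auto)
  moreover have "sum g A \<le> 0" by (rule sum_nonpos) (use neg in auto)
  ultimately show ?thesis by (simp add: sum_negf)
next
  case False
  then have pos: "0 \<le> g j" if "j \<in> A" for j using that by force
  have "(\<Sum>j\<in>A. \<bar>g j\<bar>) = (\<Sum>j\<in>A. g j)"
    by (rule sum.cong) (use pos in auto)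
  moreover have "0 \<le> sum g A" by (rule sum_nonneg) (use pos in auto)
  ultimately show ?thesis by simp
qed

text \<open>The terms need not be distinct: before a sequence can turn, it may pause. If an increasing
  sequence decreases in its last step, then its last strict increase would end at the value where
  the decrease starts, which is the forbidden configuration; hence it was constant before.\<close>

lemma monotone_extend:
  fixes a :: "nat \<Rightarrow> real"
  assumes no_turn: "\<And>i. i < m \<Longrightarrow> a (Suc i) = a m \<Longrightarrow> 0 \<le> (a (Suc i) - a i) * (a (Suc m) - a m)"
    and mono: "\<And>i. i < m \<Longrightarrow> a i \<le> a (Suc i)"
  shows "(\<forall>i<Suc m. a i \<le> a (Suc i)) \<or> (\<forall>i<Suc m. a (Suc i) \<le> a i)"
proof (cases "a m \<le> a (Suc m)")
  case True
  then show ?thesis using mono less_Suc_eq by auto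
next
  case False
  have const: "a i = a m" if "i \<le> m" for i
    using that
  proof (induction i rule: inc_induct)
    case base
    show ?case ..
  next
    case (step n)
    then show ?case using no_turn[of n] mono[of n] False
      by (auto simp: zero_le_mult_iff)
  qed
  have "a (Suc i) \<le> a i" if "i < Suc m" for i
    using const[of i] const[of "Suc i"] False that by (cases "i = m") auto
  then show ?thesis by blast
qed

text \<open>The hypothesis forbids a step that starts at the value where an earlier step in the opposite
  direction ended. It mentions arbitrary pairs of steps and not only consecutive ones, since the
  cut coordinate of an edge is at rest while a path runs through other edges.\<close>

lemma variation_no_turn:
  fixes a :: "nat \<Rightarrow> real"
  assumes "\<And>i j. i < j \<Longrightarrow> j < m \<Longrightarrow> a (Suc i) = a j \<Longrightarrow>
             0 \<le> (a (Suc i) - a i) * (a (Suc j) - a j)"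
  shows "(\<Sum>i<m. \<bar>a (Suc i) - a i\<bar>) = \<bar>a m - a 0\<bar>"
proof -
  have "(\<forall>i<m. a i \<le> a (Suc i)) \<or> (\<forall>i<m. a (Suc i) \<le> a i)"
    using assms
  proof (induction m)
    case 0
    then show ?case by simp
  next
    case (Suc m)
    have IH: "(\<forall>i<m. a i \<le> a (Suc i)) \<or> (\<forall>i<m. a (Suc i) \<le> a i)"
      by (rule Suc.IH) (use Suc.prems in auto)
    have turn: "0 \<le> (a (Suc i) - a i) * (a (Suc m) - a m)" if "i < m" "a (Suc i) = a m" for i
      using Suc.prems[of i m] that by simp
    have turn': "0 \<le> (- a (Suc i) - - a i) * (- a (Suc m) - - a m)"
      if "i < m" "a (Suc i) = a m" for i
      using turn[OF that] by (simp add: algebra_simps)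
    show ?case
      using IH monotone_extend[of m a] monotone_extend[of m "\<lambda>i. - a i"] turn turn'
      by auto
  qed
  then have "\<bar>\<Sum>i<m. a (Suc i) - a i\<bar> = (\<Sum>i<m. \<bar>a (Suc i) - a i\<bar>)"
    by (intro abs_sum_same_sign) (auto simp: zero_le_mult_iff)
  then show ?thesis by (simp add: sum_lessThan_telescope)
qed

section \<open>Pairing terminals so that every cut is crossed\<close>

text \<open>Two bipartitions of \<open>L\<close>, given by one side each, do not cross if one of their four common
  refinements is empty.\<close>

definition compatible_on :: "'a set \<Rightarrow> 'a set \<Rightarrow> 'a set \<Rightarrow> bool" where
  "compatible_on L S T \<longleftrightarrow>
     L \<inter> S \<inter> T = {} \<or> L \<inter> S - T = {} \<or> L \<inter> T - S = {} \<or> L - S - T = {}"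

text \<open>The starting point of the optimization: a pairing in which elements of \<open>L\<close> may be used
  repeatedly, so that neither parity nor a smaller number of leaves needs separate treatment.\<close>

lemma surjective_pair_exists:
  fixes L :: "'a set"
  assumes "finite L" "L \<noteq> {}" "card L \<le> 2 * CARD('n::finite)"
  shows "\<exists>(a :: 'n \<Rightarrow> 'a) (b :: 'n \<Rightarrow> 'a). range a \<union> range b = L"
proof -
  have "card L \<le> card (UNIV :: ('n \<times> bool) set)"
    using assms(3) by (simp add: card_cartesian_product mult.commute flip: UNIV_Times_UNIV)
  then obtain g :: "'a \<Rightarrow> 'n \<times> bool" where g: "inj_on g L"
    using card_le_inj[OF assms(1) finite, of "UNIV :: ('n \<times> bool) set"] by auto
  obtain c where c: "c \<in> L" using assms(2) by blast
  define h where "h k = (if k \<in> g ` L then inv_into L g k else c)" for k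
  have "h k \<in> L" for k using c by (auto simp: h_def inv_into_into)
  moreover have "h (g x) = x" if "x \<in> L" for x using that g by (simp add: h_def)
  ultimately have "range (\<lambda>i. h (i, True)) \<union> range (\<lambda>i. h (i, False)) = L"
    by (auto simp: image_iff) (metis (full_types) surj_pair)
  then show ?thesis by blast
qed

text \<open>Exchanging partners turns the pairs \<open>(a i, b i)\<close> and \<open>(a j, b j)\<close> into \<open>(a i, a j)\<close> and
  \<open>(b i, b j)\<close>, and leaves the others alone.\<close>

lemma swap_pair_separation:
  fixes a b :: "'n::finite \<Rightarrow> 'a"
  assumes "i \<noteq> j"
    and "P (a i) (b i) + P (a j) (b j) + c \<le> P (a i) (a j) + P (b i) (b j)"
  shows "(\<Sum>k\<in>UNIV. P (a k) (b k)) + (c::nat)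
    \<le> (\<Sum>k\<in>UNIV. P ((a(j := b i)) k) ((b(i := a j)) k))"
proof -
  have split: "sum g UNIV = g i + g j + sum g (UNIV - {i, j})" for g :: "'n \<Rightarrow> nat"
  proof -
    have "sum g UNIV = sum g {i, j} + sum g (UNIV - {i, j})"
      using sum.subset_diff[of "{i, j}" UNIV g] by (simp add: add.commute)
    then show ?thesis using assms(1) by simp
  qed
  have "(\<Sum>k\<in>UNIV - {i, j}. P ((a(j := b i)) k) ((b(i := a j)) k))
      = (\<Sum>k\<in>UNIV - {i, j}. P (a k) (b k))"
    by (rule sum.cong) auto
  moreover have "P (b i) (b j) = P ((a(j := b i)) j) ((b(i := a j)) j)"
    using assms(1) by simp
  ultimately show ?thesis
    unfolding split using assms by simp
qed

text \<open>A pairing that maximizes the number of separations crosses every cut. For a cut \<open>e\<close> that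
  separates no pair, pick pairs \<open>i\<close> and \<open>j\<close> on different sides. Another cut could lose from the
  exchange of partners only if it separated both old pairs, and then it would cross \<open>e\<close>.\<close>

lemma pairing_crossing_all_cuts:
  fixes S :: "'e \<Rightarrow> 'a set"
  assumes fin: "finite I" "finite L"
    and card: "card L \<le> 2 * CARD('n::finite)"
    and compat: "\<And>e f. e \<in> I \<Longrightarrow> f \<in> I \<Longrightarrow> compatible_on L (S e) (S f)"
    and proper: "\<And>e. e \<in> I \<Longrightarrow> L \<inter> S e \<noteq> {} \<and> L - S e \<noteq> {}"
  shows "\<exists>(a :: 'n \<Rightarrow> 'a) b. \<forall>e\<in>I. \<exists>i. a i \<in> L \<and> b i \<in> L \<and> (a i \<in> S e) \<noteq> (b i \<in> S e)"
proof (cases "I = {}")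
  case True
  then show ?thesis by blast
next
  case False
  then have "L \<noteq> {}" using proper by blast
  define sep where "sep e x y = (of_bool ((x \<in> S e) \<noteq> (y \<in> S e)) :: nat)" for e x y
  define score where "score c = (\<Sum>e\<in>I. \<Sum>i\<in>UNIV. sep e (fst c i) (snd c i))"
    for c :: "('n \<Rightarrow> 'a) \<times> ('n \<Rightarrow> 'a)"
  define admissible where "admissible c \<longleftrightarrow> range (fst c) \<union> range (snd c) = L"
    for c :: "('n \<Rightarrow> 'a) \<times> ('n \<Rightarrow> 'a)"
  define N where "N = (\<Sum>e\<in>I. \<Sum>i\<in>(UNIV :: 'n set). (1 :: nat))"
  have bounded: "score c < Suc N" for c
    unfolding score_def N_def less_Suc_eq_le by (intro sum_mono) (simp add: sep_def)
  obtain c0 where "admissible c0"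
    using surjective_pair_exists[OF fin(2) \<open>L \<noteq> {}\<close> card] by (auto simp: admissible_def)
  then obtain c where c: "admissible c" and max: "\<And>c'. admissible c' \<Longrightarrow> score c' \<le> score c"
    using ex_has_greatest_nat[of admissible c0 score "Suc N"] bounded by blast
  obtain a b where ab: "c = (a, b)" by fastforce
  have L: "range a \<union> range b = L" using c by (simp add: admissible_def ab)
  have "\<exists>i. (a i \<in> S e) \<noteq> (b i \<in> S e)" if e: "e \<in> I" for e
  proof (rule ccontr)
    assume "\<not> ?thesis"
    then have same: "a i \<in> S e \<longleftrightarrow> b i \<in> S e" for i by blast
    obtain i where i: "a i \<in> S e" "b i \<in> S e"
      using proper[OF e] L same by blast
    obtain j where j: "a j \<notin> S e" "b j \<notin> S e"
      using proper[OF e] L same by blast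
    have "i \<noteq> j" using i j by blast
    define a' b' where "a' = a(j := b i)" and "b' = b(i := a j)"
    have inL: "a k \<in> L" "b k \<in> L" for k using L by blast+
    have "range a' \<union> range b' = L"
    proof
      show "range a' \<union> range b' \<subseteq> L" using inL by (auto simp: a'_def b'_def)
      have "a k \<in> range a' \<union> range b'" for k
      proof (cases "k = j")
        case True
        then have "a k = b' i" by (simp add: b'_def)
        then show ?thesis by blast
      next
        case False
        then have "a k = a' k" by (simp add: a'_def)
        then show ?thesis by blast
      qed
      moreover have "b k \<in> range a' \<union> range b'" for k
      proof (cases "k = i")
        case True
        then have "b k = a' j" by (simp add: a'_def)
        then show ?thesis by blast
      next
        case False
        then have "b k = b' k" by (simp add: b'_def)
        then show ?thesis by blast
      qed
      ultimately show "L \<subseteq> range a' \<union> range b'" using L by blast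
    qed
    then have "admissible (a', b')" by (simp add: admissible_def)
    have step: "(\<Sum>k\<in>UNIV. sep f (a k) (b k)) + of_bool (f = e)
        \<le> (\<Sum>k\<in>UNIV. sep f (a' k) (b' k))" if f: "f \<in> I" for f
      unfolding a'_def b'_def
    proof (rule swap_pair_separation[OF \<open>i \<noteq> j\<close>])
      have "compatible_on L (S e) (S f)" using compat e f by blast
      \<comment> \<open>If \<open>f\<close> separates both old pairs, then the four elements lie in four different corners of
        \<open>e\<close> and \<open>f\<close>.\<close>
      then have "\<not> (a i \<in> S f \<and> b i \<notin> S f \<and> a j \<in> S f \<and> b j \<notin> S f)"
        "\<not> (a i \<in> S f \<and> b i \<notin> S f \<and> a j \<notin> S f \<and> b j \<in> S f)"
        "\<not> (a i \<notin> S f \<and> b i \<in> S f \<and> a j \<in> S f \<and> b j \<notin> S f)"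
        "\<not> (a i \<notin> S f \<and> b i \<in> S f \<and> a j \<notin> S f \<and> b j \<in> S f)"
        using i j inL unfolding compatible_on_def by blast+
      then show "sep f (a i) (b i) + sep f (a j) (b j) + of_bool (f = e)
          \<le> sep f (a i) (a j) + sep f (b i) (b j)"
        using i j by (auto simp: sep_def)
    qed
    have "score c < score (a', b')"
      unfolding score_def ab fst_conv snd_conv
    proof (rule sum_strict_mono_ex1[OF fin(1)])
      show "\<forall>f\<in>I. (\<Sum>k\<in>UNIV. sep f (a k) (b k)) \<le> (\<Sum>k\<in>UNIV. sep f (a' k) (b' k))"
        using step add_leD1 by blast
      show "\<exists>f\<in>I. (\<Sum>k\<in>UNIV. sep f (a k) (b k)) < (\<Sum>k\<in>UNIV. sep f (a' k) (b' k))"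
        using step[OF e] e by (intro bexI[of _ e]) auto
    qed
    then show False using max[OF \<open>admissible (a', b')\<close>] by simp
  qed
  moreover have "a i \<in> L" "b i \<in> L" for i using L by auto
  ultimately show ?thesis by blast
qed

section \<open>Branches of a tree\<close>

text \<open>The vertex set of the connected component of \<open>v\<close> after the edge \<open>e\<close> has been deleted.\<close>

definition branch :: "'a set set \<Rightarrow> 'a set \<Rightarrow> 'a \<Rightarrow> 'a set" where
  "branch E e v = {z. (adjacent (E - {e}))\<^sup>*\<^sup>* v z}"

lemma adjacent_sym: "adjacent E x y \<Longrightarrow> adjacent E y x"
  by (simp add: adjacent_def insert_commute)

lemma branch_sym: "x \<in> branch E e y \<Longrightarrow> y \<in> branch E e x"
  unfolding branch_def mem_Collect_eq
  by (rule sympD[OF symp_rtranclp]) (auto intro: sympI adjacent_sym)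

lemma branch_trans: "y \<in> branch E e x \<Longrightarrow> z \<in> branch E e y \<Longrightarrow> z \<in> branch E e x"
  by (simp add: branch_def)

lemma branch_self: "v \<in> branch E e v"
  by (simp add: branch_def)

lemma branch_step:
  assumes "{x, y} \<in> E" "{x, y} \<noteq> e" "x \<in> branch E e v"
  shows "y \<in> branch E e v"
proof -
  have "adjacent (E - {e}) x y" using assms by (simp add: adjacent_def)
  then show ?thesis
    using assms(3) rtranclp.rtrancl_into_rtrancl[of "adjacent (E - {e})" v x y]
    by (simp add: branch_def)
qed

text \<open>Loops are cut out as soon as they arise: when the path returns to a vertex, everything after
  the first visit is dropped.\<close>

lemma distinct_path_exists:
  assumes "(adjacent F)\<^sup>*\<^sup>* x y"
  shows "\<exists>vs. vs \<noteq> [] \<and> hd vs = x \<and> last vs = y \<and> distinct vs \<and> successively (adjacent F) vs"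
  using assms
proof (induction rule: rtranclp_induct)
  case base
  show ?case by (rule exI[of _ "[x]"]) simp
next
  case (step y z)
  then obtain vs where vs: "vs \<noteq> []" "hd vs = x" "last vs = y" "distinct vs"
    "successively (adjacent F) vs" by blast
  show ?case
  proof (cases "z \<in> set vs")
    case True
    then obtain us ws where split: "vs = us @ z # ws" by (meson split_list)
    then have "successively (adjacent F) ((us @ [z]) @ ws)" using vs by simp
    then have "successively (adjacent F) (us @ [z])" by (simp only: successively_append_iff)
    moreover have "hd (us @ [z]) = x" using vs split by (cases us) auto
    ultimately show ?thesis using vs split by (intro exI[of _ "us @ [z]"]) simp
  next
    case False
    then show ?thesis using vs step
      by (intro exI[of _ "vs @ [z]"]) (auto simp: successively_append_iff)
  qed
qed

locale tree =
  fixes V :: "'a set" and E :: "'a set set"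
  assumes tree: "finite_tree V E"
begin

lemma finite_V: "finite V"
  using tree by (simp add: finite_tree_def finite_simple_graph_def)

lemma edge_subset: "e \<in> E \<Longrightarrow> e \<subseteq> V"
  using tree by (simp add: finite_tree_def finite_simple_graph_def)

lemma edge_card: "e \<in> E \<Longrightarrow> card e = 2"
  using tree by (simp add: finite_tree_def finite_simple_graph_def)

lemma finite_E: "finite E"
  by (rule finite_subset[of E "Pow V"]) (use edge_subset finite_V in auto)

lemma edge_obtain:
  assumes "e \<in> E" "v \<in> e"
  obtains u where "e = {u, v}" "u \<noteq> v"
  using edge_card[OF assms(1)] assms(2) that by (auto simp: card_2_iff)

lemma edge_in_branch:
  assumes "f \<in> E" "f \<noteq> e"
  shows "f \<subseteq> branch E e v \<or> f \<inter> branch E e v = {}"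
proof -
  obtain x y where f: "f = {x, y}" using edge_card[OF assms(1)] by (auto simp: card_2_iff)
  then show ?thesis
    using branch_step[of x y E e v] branch_step[of y x E e v] assms
    by (auto simp: insert_commute)
qed

lemma branch_subset:
  assumes "v \<in> V"
  shows "branch E e v \<subseteq> V"
proof
  fix z assume "z \<in> branch E e v"
  then have "(adjacent (E - {e}))\<^sup>*\<^sup>* v z" by (simp add: branch_def)
  then show "z \<in> V"
    by (induction rule: rtranclp_induct) (use assms edge_subset in \<open>auto simp: adjacent_def\<close>)
qed

lemma finite_branch: "e \<in> E \<Longrightarrow> v \<in> e \<Longrightarrow> finite (branch E e v)"
  using branch_subset edge_subset finite_V finite_subset by (metis subsetD)

text \<open>This is where acyclicity enters: a path from \<open>v\<close> to \<open>u\<close> that avoids \<open>e\<close> would be closed to a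
  cycle by \<open>e\<close>. The path has at least three vertices, as its only way to have two would be to
  use \<open>e\<close>.\<close>

lemma other_end_notin_branch:
  assumes e: "e \<in> E" "e = {u, v}" "u \<noteq> v"
  shows "u \<notin> branch E e v"
proof
  assume "u \<in> branch E e v"
  then obtain vs where vs: "vs \<noteq> []" "hd vs = v" "last vs = u" "distinct vs"
    "successively (adjacent (E - {e})) vs"
    using distinct_path_exists by (force simp: branch_def)
  have "length vs \<noteq> 1" using vs e by (auto simp: length_Suc_conv)
  moreover have "length vs \<noteq> 2"
    using vs e by (auto simp: numeral_2_eq_2 length_Suc_conv adjacent_def insert_commute)
  moreover have "length vs \<noteq> 0" using vs by simp
  ultimately have "3 \<le> length vs" by linarith
  moreover have "successively (adjacent E) vs"
    using vs(5) by (rule successively_mono) (simp add: adjacent_def)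
  moreover have "adjacent E (last vs) (hd vs)" using vs e by (simp add: adjacent_def)
  ultimately have "graph_cycle E vs" using vs by (simp add: graph_cycle_def)
  then show False using tree by (auto simp: finite_tree_def)
qed

lemma connected: "x \<in> V \<Longrightarrow> y \<in> V \<Longrightarrow> (adjacent E)\<^sup>*\<^sup>* x y"
proof -
  assume "x \<in> V" "y \<in> V"
  then obtain vs where vs: "vs \<noteq> []" "hd vs = x" "last vs = y" "successively (adjacent E) vs"
    using tree unfolding finite_tree_def connected_graph_def by blast
  have "(adjacent E)\<^sup>*\<^sup>* (hd vs) (last vs)"
    using vs(1,4)
  proof (induction vs rule: induct_list012)
    case (3 x y zs)
    then have "(adjacent E)\<^sup>*\<^sup>* y (last (y # zs))" "adjacent E x y" by auto
    then show ?case using converse_rtranclp_into_rtranclp[of "adjacent E" x y] by simp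
  qed auto
  then show ?thesis using vs by simp
qed

text \<open>This is where connectedness enters: a path that starts at \<open>u\<close> is always in one of the two
  branches, since it can change between them through \<open>e\<close> only.\<close>

lemma other_branch:
  assumes e: "e \<in> E" "e = {u, v}" "u \<noteq> v"
  shows "branch E e u = V - branch E e v"
proof -
  have uv: "u \<in> V" "v \<in> V" using edge_subset e by blast+
  have "z \<in> branch E e u \<or> z \<in> branch E e v" if "z \<in> V" for z
    using connected[OF uv(1) that]
  proof (induction rule: rtranclp_induct)
    case base
    show ?case by (simp add: branch_self)
  next
    case (step y z)
    show ?case
    proof (cases "{y, z} = e")
      case True
      then show ?thesis using e branch_self[of _ E e] by (metis insertI1 insert_iff singletonD insert_commute)
    next
      case False
      then show ?thesis using step branch_step[of y z E e] by (auto simp: adjacent_def)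
    qed
  qed
  moreover have "z \<notin> branch E e v" if "z \<in> branch E e u" for z
    using that other_end_notin_branch[OF e] branch_sym branch_trans by metis
  ultimately show ?thesis using branch_subset[OF uv(1)] by blast
qed

text \<open>A branch that does not meet \<open>f\<close> remains connected when \<open>f\<close> is deleted.\<close>

lemma branch_uncrossed:
  assumes f: "f \<in> E" "f \<inter> branch E e v = {}"
  shows "branch E e v \<subseteq> branch E f u \<or> branch E e v \<inter> branch E f u = {}"
proof -
  have "z \<in> branch E f u \<longleftrightarrow> v \<in> branch E f u" if "z \<in> branch E e v" for z
  proof -
    from that have "(adjacent (E - {e}))\<^sup>*\<^sup>* v z" by (simp add: branch_def)
    then show ?thesis
    proof (induction rule: rtranclp_induct)
      case base
      show ?case ..
    next
      case (step y z)
      have "y \<in> branch E e v" using step by (simp add: branch_def)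
      then have "{y, z} \<noteq> f" using f by blast
      then have "z \<in> branch E f u \<longleftrightarrow> y \<in> branch E f u"
        using branch_step[of y z E f u] branch_step[of z y E f u] step(2)
        by (auto simp: adjacent_def insert_commute)
      then show ?case using step.IH by simp
    qed
  qed
  then show ?thesis by blast
qed

text \<open>The edge \<open>f\<close> is disjoint from one of the two branches at \<open>e\<close>, and that branch lies on a
  single side of \<open>f\<close>.\<close>

lemma branch_compatible:
  assumes e: "e \<in> E" "v \<in> e" and f: "f \<in> E" "u \<in> f"
  shows "compatible_on V (branch E e v) (branch E f u)"
proof (cases "e = f")
  case True
  obtain u' where u': "e = {u', v}" "u' \<noteq> v" using edge_obtain e by blast
  have "branch E e u' = V - branch E e v" using other_branch[OF e(1) u'] .
  then show ?thesis
    using True f(2) u' by (auto simp: compatible_on_def)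
next
  case False
  obtain v' where v': "e = {v', v}" "v' \<noteq> v" using edge_obtain e by blast
  have opp: "branch E e v' = V - branch E e v" using other_branch[OF e(1) v'] .
  consider "f \<subseteq> branch E e v" | "f \<inter> branch E e v = {}"
    using edge_in_branch f False by blast
  then show ?thesis
  proof cases
    case 1
    then have "f \<inter> branch E e v' = {}" using opp by blast
    then show ?thesis using branch_uncrossed[OF f(1), of e v' u] opp
      by (auto simp: compatible_on_def)
  next
    case 2
    then show ?thesis using branch_uncrossed[OF f(1), of e v u]
      by (auto simp: compatible_on_def)
  qed
qed

text \<open>If \<open>v\<close> itself is not a leaf, then a further edge at \<open>v\<close> leads into a smaller branch inside
  the given one.\<close>

lemma branch_contains_leaf:
  assumes "e \<in> E" "v \<in> e"
  shows "leaves V E \<inter> branch E e v \<noteq> {}"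
  using assms
proof (induction "card (branch E e v)" arbitrary: e v rule: less_induct)
  case less
  note e = less.prems
  obtain u where u: "e = {u, v}" "u \<noteq> v" using edge_obtain e by blast
  show ?case
  proof (cases "\<exists>f\<in>E. v \<in> f \<and> f \<noteq> e")
    case False
    then have "{f\<in>E. v \<in> f} = {e}" using e by blast
    then have "v \<in> leaves V E" using e edge_subset by (auto simp: leaves_def vertex_degree_def)
    then show ?thesis using branch_self[of v E e] by blast
  next
    case True
    then obtain f where f: "f \<in> E" "v \<in> f" "f \<noteq> e" by blast
    obtain z where z: "f = {z, v}" "z \<noteq> v" using edge_obtain f by blast
    have z': "f = {v, z}" "v \<noteq> z" using z by auto
    have v_out: "v \<notin> branch E f z" using other_end_notin_branch[OF f(1) z'] .
    have "{u, v} \<noteq> f" using f u by simp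
    then have u_out: "u \<notin> branch E f z"
      using branch_step[of u v E f z] v_out e u by auto
    have f_in: "f \<subseteq> branch E e v"
      using edge_in_branch[OF f(1) f(3), of v] f(2) branch_self[of v E e] by blast
    have opp: "branch E e u = V - branch E e v" using other_branch[OF e(1) u] .
    then have "f \<inter> branch E e u = {}" using f_in by blast
    then have "branch E e u \<inter> branch E f z = {}"
      using branch_uncrossed[OF f(1), of e u z] u_out branch_self[of u E e] by blast
    moreover have "branch E f z \<subseteq> V" using branch_subset edge_subset f(1) z by blast
    ultimately have sub: "branch E f z \<subseteq> branch E e v" using opp by blast
    have "branch E f z \<subset> branch E e v"
      using sub v_out branch_self[of v E e] by blast
    then have "card (branch E f z) < card (branch E e v)"
      using finite_branch[OF e] by (rule psubset_card_mono[rotated])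
    then have "leaves V E \<inter> branch E f z \<noteq> {}"
      using less.hyps[of f z] f(1) z by blast
    then show ?thesis using sub by blast
  qed
qed

section \<open>Cut coordinates of the points of a tree\<close>

text \<open>The cut coordinate of a point \<open>p\<close> with respect to the branch of \<open>e\<close> at \<open>v\<close> is
  \<open>sum p (branch E e v)\<close>.\<close>

lemma branch_inter_edge:
  assumes "e \<in> E" "v \<in> e"
  shows "branch E e v \<inter> e = {v}"
proof -
  obtain u where u: "e = {u, v}" "u \<noteq> v" using edge_obtain assms by blast
  then show ?thesis using other_end_notin_branch[OF assms(1) u] branch_self[of v E e] by auto
qed

end

lemma sum_cell_Int:
  assumes "p \<in> cell s" "finite S"
  shows "sum p S = sum p (S \<inter> s)"
  using assms by (intro sum.mono_neutral_right) (auto simp: cell_def)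

lemma sum_cell_superset:
  assumes "p \<in> cell s" "finite S" "s \<subseteq> S"
  shows "sum p S = 1"
  using sum_cell_Int[OF assms(1,2)] assms by (simp add: Int_absorb1 cell_def)

lemma sum_cell_disjoint:
  assumes "p \<in> cell s" "finite S" "s \<inter> S = {}"
  shows "sum p S = 0"
  using sum_cell_Int[OF assms(1,2)] assms by (simp add: Int_commute)

lemma sum_cell_le_1:
  assumes "p \<in> cell s" "finite S" "finite s"
  shows "sum p S \<le> 1"
proof -
  have "sum p (S \<inter> s) \<le> sum p s"
    using assms by (intro sum_mono2) (auto simp: cell_def)
  then show ?thesis using sum_cell_Int[OF assms(1,2)] assms by (simp add: cell_def)
qed

lemma straight_segment_subset_cell:
  assumes "p \<in> cell s" "q \<in> cell s"
  shows "straight_segment p q \<subseteq> cell s"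
proof
  fix z assume "z \<in> straight_segment p q"
  then obtain t where t: "0 \<le> t" "t \<le> 1" "z = (\<lambda>v. (1 - t) * p v + t * q v)"
    by (auto simp: straight_segment_def)
  have "sum z s = (1 - t) * sum p s + t * sum q s"
    by (simp add: t sum.distrib sum_distrib_left)
  then show "z \<in> cell s" using assms t by (auto simp: cell_def)
qed

lemma straight_segment_ends: "p \<in> straight_segment p q" "q \<in> straight_segment p q"
  unfolding straight_segment_def
  by (auto intro: exI[of _ "0::real"] exI[of _ "1::real"])

context tree
begin

lemma edge_finite: "e \<in> E \<Longrightarrow> finite e"
  using edge_subset finite_V finite_subset by blast

lemma cut_on_edge:
  assumes "e \<in> E" "v \<in> e" "p \<in> cell e"
  shows "sum p (branch E e v) = p v"
  using sum_cell_Int[OF assms(3) finite_branch[OF assms(1,2)]] branch_inter_edge[OF assms(1,2)]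
  by simp

text \<open>An edge other than \<open>e\<close> lies on one side of \<open>e\<close>, so the coordinate is 0 or 1 on all of it.\<close>

lemma cut_off_edge:
  assumes "e \<in> E" "v \<in> e" "f \<in> E" "f \<noteq> e" "p \<in> cell f" "q \<in> cell f"
  shows "sum p (branch E e v) = sum q (branch E e v)"
  using edge_in_branch[OF assms(3,4), of v] finite_branch[OF assms(1,2)] assms(5,6)
  by (metis sum_cell_superset sum_cell_disjoint)

lemma cell_edge_other:
  assumes "p \<in> cell {u, v}" "u \<noteq> v"
  shows "p u = 1 - p v"
  using assms by (auto simp: cell_def)

lemma cell_edge_eqI:
  assumes e: "e \<in> E" "v \<in> e" and pq: "p \<in> cell e" "q \<in> cell e" "p v = q v"
  shows "p = q"
proof
  fix z
  obtain u where u: "e = {u, v}" "u \<noteq> v" using edge_obtain e by blast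
  have "p u = q u" using pq u cell_edge_other by metis
  then show "p z = q z" using pq u by (cases "z \<in> e") (auto simp: cell_def)
qed

text \<open>Within one edge, the barycentric coordinate at \<open>v\<close> identifies the cell with the real unit
  interval and segments with intervals.\<close>

lemma straight_segment_edge:
  assumes e: "e \<in> E" "v \<in> e" and pq: "p \<in> cell e" "q \<in> cell e"
  shows "straight_segment p q = {z \<in> cell e. z v \<in> closed_segment (p v) (q v)}"
proof (intro set_eqI iffI)
  fix z assume z: "z \<in> straight_segment p q"
  moreover have "z \<in> cell e" using z straight_segment_subset_cell pq by blast
  ultimately show "z \<in> {z \<in> cell e. z v \<in> closed_segment (p v) (q v)}"
    by (auto simp: straight_segment_def closed_segment_def)
next
  fix z assume z: "z \<in> {z \<in> cell e. z v \<in> closed_segment (p v) (q v)}"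
  then obtain t where t: "0 \<le> t" "t \<le> 1" "z v = (1 - t) * p v + t * q v"
    by (auto simp: closed_segment_def)
  define y where "y = (\<lambda>v. (1 - t) * p v + t * q v)"
  have y: "y \<in> straight_segment p q" using t by (auto simp: straight_segment_def y_def)
  then have "y \<in> cell e" using straight_segment_subset_cell pq by blast
  then have "z = y" using cell_edge_eqI[OF e, of z y] z t by (simp add: y_def)
  then show "z \<in> straight_segment p q" using y by simp
qed

lemma segment_length_edge:
  assumes e: "e \<in> E" "v \<in> e" and pq: "p \<in> cell e" "q \<in> cell e"
  shows "segment_length w e p q = w e * \<bar>p v - q v\<bar>"
proof -
  obtain u where u: "e = {u, v}" "u \<noteq> v" using edge_obtain e by blast
  have "p u = 1 - p v" "q u = 1 - q v" using cell_edge_other u pq by metis+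
  then show ?thesis using u by (simp add: segment_length_def abs_minus_commute)
qed

section \<open>The distance as a sum over cuts\<close>

text \<open>Only the cut at \<open>e\<close> itself contributes.\<close>

lemma segment_length_cuts:
  assumes h: "\<And>e. e \<in> E \<Longrightarrow> h e \<in> e"
    and e: "e \<in> E" and pq: "p \<in> cell e" "q \<in> cell e"
  shows "segment_length w e p q =
    (\<Sum>f\<in>E. w f * \<bar>sum q (branch E f (h f)) - sum p (branch E f (h f))\<bar>)"
proof -
  have "(\<Sum>f\<in>E. w f * \<bar>sum q (branch E f (h f)) - sum p (branch E f (h f))\<bar>)
      = (\<Sum>f\<in>{e}. w f * \<bar>sum q (branch E f (h f)) - sum p (branch E f (h f))\<bar>)"
  proof (rule sum.mono_neutral_right)
    show "\<forall>f\<in>E - {e}. w f * \<bar>sum q (branch E f (h f)) - sum p (branch E f (h f))\<bar> = 0"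
      using cut_off_edge[OF _ h e _ pq] by fastforce
  qed (use finite_E e in auto)
  also have "\<dots> = w e * \<bar>q (h e) - p (h e)\<bar>"
    using cut_on_edge[OF e h[OF e]] pq by simp
  finally show ?thesis using segment_length_edge[OF e h[OF e] pq] by (simp add: abs_minus_commute)
qed

text \<open>If the second segment runs back from the point where the first one ended, then the shorter
  of the two is contained in the other one, so they share more than a point.\<close>

lemma opposite_segments_overlap:
  assumes e: "e \<in> E" "v \<in> e"
    and cells: "p \<in> cell e" "m \<in> cell e" "m' \<in> cell e" "q \<in> cell e"
    and turn: "m v = m' v" "(m v - p v) * (q v - m' v) < 0"
    and single: "straight_segment p m \<inter> straight_segment m' q \<subseteq> {c}"
  shows False
proof -
  have m: "m' = m" using cell_edge_eqI[OF e cells(2,3) turn(1)] by simp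
  have between: "z = m" if "z \<in> cell e" "z v \<in> closed_segment (p v) (m v)"
      "z v \<in> closed_segment (m v) (q v)" for z
  proof -
    have "z \<in> straight_segment p m \<inter> straight_segment m' q"
      using that by (simp add: m straight_segment_edge[OF e] cells)
    moreover have "m \<in> straight_segment p m \<inter> straight_segment m' q"
      using straight_segment_ends m by blast
    ultimately show ?thesis using single by blast
  qed
  have "p v \<in> closed_segment (m v) (q v) \<or> q v \<in> closed_segment (p v) (m v)"
    using turn(2) by (auto simp: m closed_segment_eq_real_ivl mult_less_0_iff)
  then have "p = m \<or> q = m" using between[of p] between[of q] cells by auto
  then show False using turn(2) m by auto
qed

text \<open>For each cut, the coordinates of the successive points of a simple path form a sequence that
  does not turn, so its variation is the distance between its end values.\<close>

lemma path_length_cuts: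
  assumes h: "\<And>e. e \<in> E \<Longrightarrow> h e \<in> e"
    and path: "simple_path_between V E x y ps es"
  shows "path_length w ps es =
    (\<Sum>e\<in>E. w e * \<bar>sum y (branch E e (h e)) - sum x (branch E e (h e))\<bar>)"
proof -
  define c where "c e p = sum p (branch E e (h e))" for e and p :: "'a \<Rightarrow> real"
  define k where "k = length es"
  have ps: "length ps = Suc k" "ps ! 0 = x" "ps ! k = y"
    using path by (auto simp: simple_path_between_def k_def hd_conv_nth last_conv_nth)
       (metis Zero_not_Suc hd_conv_nth list.size(3), metis Zero_not_Suc diff_Suc_1 last_conv_nth list.size(3))
  have seg: "es ! i \<in> E" "ps ! i \<in> cell (es ! i)" "ps ! Suc i \<in> cell (es ! i)" if "i < k" for i
    using path that by (auto simp: simple_path_between_def k_def)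
  have inter: "straight_segment (ps ! i) (ps ! Suc i) \<inter> straight_segment (ps ! j) (ps ! Suc j)
      \<subseteq> {ps ! j}" if "i < j" "j < k" for i j
    using path that by (auto simp: simple_path_between_def k_def)
  have total: "(\<Sum>i<k. \<bar>c e (ps ! Suc i) - c e (ps ! i)\<bar>) = \<bar>c e y - c e x\<bar>" if e: "e \<in> E" for e
  proof -
    \<comment> \<open>Both steps of a turn move the coordinate of \<open>e\<close>, so both happen on \<open>e\<close>.\<close>
    have on_e: "es ! i = e" if "i < k" "c e (ps ! Suc i) - c e (ps ! i) \<noteq> 0" for i
      using cut_off_edge[OF e h[OF e] seg(1)[OF that(1)] _ seg(2,3)[OF that(1)]] that(2)
      unfolding c_def by (metis right_minus_eq)
    have "(\<Sum>i<k. \<bar>c e (ps ! Suc i) - c e (ps ! i)\<bar>) = \<bar>c e (ps ! k) - c e (ps ! 0)\<bar>"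
    proof (rule variation_no_turn, rule ccontr)
      fix i j
      assume ij: "i < j" "j < k" and eq: "c e (ps ! Suc i) = c e (ps ! j)"
        and "\<not> 0 \<le> (c e (ps ! Suc i) - c e (ps ! i)) * (c e (ps ! Suc j) - c e (ps ! j))"
      then have neg: "(c e (ps ! Suc i) - c e (ps ! i)) * (c e (ps ! Suc j) - c e (ps ! j)) < 0"
        by simp
      then have "es ! i = e" "es ! j = e" using on_e[of i] on_e[of j] ij by force+
      then have cells: "ps ! i \<in> cell e" "ps ! Suc i \<in> cell e" "ps ! j \<in> cell e" "ps ! Suc j \<in> cell e"
        using seg[of i] seg[of j] ij by auto
      have "c e p = p (h e)" if "p \<in> cell e" for p
        using cut_on_edge[OF e h[OF e] that] by (simp add: c_def)
      then show False
        using opposite_segments_overlap[OF e h[OF e] cells _ _ inter[OF ij]] eq neg cells by simp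
    qed
    then show ?thesis using ps by simp
  qed
  have "path_length w ps es = (\<Sum>i<k. \<Sum>e\<in>E. w e * \<bar>c e (ps ! Suc i) - c e (ps ! i)\<bar>)"
    unfolding path_length_def c_def k_def[symmetric]
    by (rule sum.cong) (use seg segment_length_cuts[OF h] in auto)
  also have "\<dots> = (\<Sum>e\<in>E. w e * (\<Sum>i<k. \<bar>c e (ps ! Suc i) - c e (ps ! i)\<bar>))"
    by (subst sum.swap) (simp add: sum_distrib_left)
  also have "\<dots> = (\<Sum>e\<in>E. w e * \<bar>c e y - c e x\<bar>)"
    by (rule sum.cong) (use total in auto)
  finally show ?thesis by (simp add: c_def)
qed

definition same_edge :: "('a \<Rightarrow> real) \<Rightarrow> ('a \<Rightarrow> real) \<Rightarrow> bool" where
  "same_edge p q \<longleftrightarrow> (\<exists>e\<in>E. p \<in> cell e \<and> q \<in> cell e)"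

text \<open>The point \<open>\<lambda>z. of_bool (z = v)\<close> is the vertex \<open>v\<close> in barycentric coordinates.\<close>

lemma vertex_cell: "cell {v} = {\<lambda>z. of_bool (z = v)}"
  by (auto simp: cell_def fun_eq_iff)

lemma vertex_in_edge_cell:
  assumes "e \<in> E" "v \<in> e"
  shows "(\<lambda>z. of_bool (z = v)) \<in> cell e"
  using assms edge_finite by (auto simp: cell_def)

lemma vertices_chain:
  assumes "(adjacent E)\<^sup>*\<^sup>* u v"
  shows "same_edge\<^sup>*\<^sup>* (\<lambda>z. of_bool (z = u)) (\<lambda>z. of_bool (z = v))"
  using assms
proof (induction rule: rtranclp_induct)
  case base
  show ?case by simp
next
  case (step v t)
  have "same_edge (\<lambda>z. of_bool (z = v)) (\<lambda>z. of_bool (z = t))"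
    using step(2) vertex_in_edge_cell[of "{v, t}"] by (auto simp: same_edge_def adjacent_def)
  then show ?case using step.IH by simp
qed

lemma point_near_vertex:
  assumes "p \<in> tree_points V E"
  obtains v where "v \<in> V" "same_edge\<^sup>*\<^sup>* p (\<lambda>z. of_bool (z = v))"
    "same_edge\<^sup>*\<^sup>* (\<lambda>z. of_bool (z = v)) p"
proof -
  consider v where "v \<in> V" "p \<in> cell {v}" | e where "e \<in> E" "p \<in> cell e"
    using assms by (auto simp: tree_points_def)
  then show ?thesis
  proof cases
    case 1
    then show ?thesis using that[of v] by (simp add: vertex_cell)
  next
    case 2
    obtain v where v: "v \<in> e" using edge_card[OF 2(1)] by fastforce
    then have "same_edge p (\<lambda>z. of_bool (z = v))" "same_edge (\<lambda>z. of_bool (z = v)) p"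
      using 2 vertex_in_edge_cell by (auto simp: same_edge_def)
    then show ?thesis using that[of v] v edge_subset[OF 2(1)] by blast
  qed
qed

lemma points_chain:
  assumes "x \<in> tree_points V E" "y \<in> tree_points V E"
  shows "same_edge\<^sup>*\<^sup>* x y"
proof -
  obtain u where u: "u \<in> V" "same_edge\<^sup>*\<^sup>* x (\<lambda>z. of_bool (z = u))"
    using point_near_vertex[OF assms(1)] by blast
  obtain v where v: "v \<in> V" "same_edge\<^sup>*\<^sup>* (\<lambda>z. of_bool (z = v)) y"
    using point_near_vertex[OF assms(2)] by blast
  show ?thesis
    using u(2) vertices_chain[OF connected[OF u(1) v(1)]] v(2) by (meson rtranclp_trans)
qed

lemma cells_meet_once:
  assumes "e \<in> E" "f \<in> E" "e \<noteq> f" "p \<in> cell e" "p \<in> cell f" "q \<in> cell e" "q \<in> cell f"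
  shows "p = q"
proof -
  obtain v where v: "v \<in> e" "v \<notin> f"
    using assms(1-3) edge_card edge_finite by (metis card_subset_eq subsetI)
  then show ?thesis using cell_edge_eqI[OF assms(1) v(1) assms(4,6)] assms(5,7)
    by (simp add: cell_def)
qed

text \<open>A chain of points with the least possible number of steps, each within an edge, is simple.
  A common point of two nonadjacent segments would be a shortcut, and two adjacent segments in the
  same edge could be merged; adjacent segments in different edges meet in one point only.\<close>

lemma simple_path_exists:
  assumes xy: "x \<in> tree_points V E" "y \<in> tree_points V E"
  shows "\<exists>ps es. simple_path_between V E x y ps es"
proof -
  define k where "k = (LEAST k. (same_edge ^^ k) x y)"
  have "\<exists>k. (same_edge ^^ k) x y" using points_chain[OF xy] by (simp add: rtranclp_power)
  then have k: "(same_edge ^^ k) x y" unfolding k_def by (rule LeastI_ex)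
  have least: "k \<le> l" if "(same_edge ^^ l) x y" for l unfolding k_def using that by (rule Least_le)
  obtain g where g: "g 0 = x" "g k = y" and "\<forall>i<k. same_edge (g i) (g (Suc i))"
    using k by (auto simp: relpowp_fun_conv)
  then obtain d where d: "\<And>i. i < k \<Longrightarrow> d i \<in> E \<and> g i \<in> cell (d i) \<and> g (Suc i) \<in> cell (d i)"
    unfolding same_edge_def by metis
  have shortcut: "j \<le> i + l" if "i \<le> j" "j \<le> k" "(same_edge ^^ l) (g i) (g j)" for i j l
  proof -
    have chain: "(same_edge ^^ n) (g m) (g (m + n))" if "m + n \<le> k" for m n
    proof -
      have "same_edge (g (m + i)) (g (m + Suc i))" if "i < n" for i
        using d[of "m + i"] that \<open>m + n \<le> k\<close> by (auto simp: same_edge_def)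
      then show ?thesis
        unfolding relpowp_fun_conv by (intro exI[of _ "\<lambda>i. g (m + i)"]) simp
    qed
    have "(same_edge ^^ i) x (g i)" using chain[of 0 i] that g by simp
    moreover have "(same_edge ^^ (k - j)) (g j) y" using chain[of j "k - j"] that g by simp
    ultimately have "(same_edge ^^ (i + l + (k - j))) x y"
      using that(3) by (auto simp: relpowp_add intro: relcomppI)
    then have "k \<le> i + l + (k - j)" by (rule least)
    then show ?thesis using that by simp
  qed
  have distinct: "g i \<noteq> g (Suc i)" if "i < k" for i
    using shortcut[of i "Suc i" 0] that by auto
  have disjoint: "straight_segment (g i) (g (Suc i)) \<inter> straight_segment (g j) (g (Suc j)) =
      (if j = Suc i then {g j} else {})" if ij: "i < j" "j < k" for i j
  proof -
    have cells: "z \<in> cell (d i)" "z \<in> cell (d j)"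
      if "z \<in> straight_segment (g i) (g (Suc i)) \<inter> straight_segment (g j) (g (Suc j))" for z
      using that straight_segment_subset_cell d[of i] d[of j] ij by (auto dest!: subsetD)
    show ?thesis
    proof (cases "j = Suc i")
      case True
      have "d i \<noteq> d j"
      proof
        assume "d i = d j"
        then have "same_edge (g i) (g (Suc j))" using d[of i] d[of j] ij by (auto simp: same_edge_def)
        then show False using shortcut[of i "Suc j" 1] ij True by auto
      qed
      then have "z = g j" if "z \<in> straight_segment (g i) (g (Suc i)) \<inter> straight_segment (g j) (g (Suc j))" for z
        using cells_meet_once[of "d i" "d j" z "g j"] cells[OF that] d[of i] d[of j] ij True by auto
      moreover have "g j \<in> straight_segment (g i) (g (Suc i)) \<inter> straight_segment (g j) (g (Suc j))"
        using True straight_segment_ends by blast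
      ultimately show ?thesis using True by auto
    next
      case False
      have "z \<notin> straight_segment (g i) (g (Suc i)) \<inter> straight_segment (g j) (g (Suc j))" for z
      proof
        assume z: "z \<in> straight_segment (g i) (g (Suc i)) \<inter> straight_segment (g j) (g (Suc j))"
        have "same_edge (g i) z" "same_edge z (g (Suc j))"
          using cells[OF z] d[of i] d[of j] ij by (auto simp: same_edge_def)
        then have "(same_edge ^^ 2) (g i) (g (Suc j))"
          by (auto simp: numeral_2_eq_2)
        then show False using shortcut[of i "Suc j" 2] ij False by auto
      qed
      then show ?thesis using False by auto
    qed
  qed
  have points: "g i \<in> tree_points V E" if "i \<le> k" for i
  proof (cases "i = k")
    case True
    then show ?thesis using g xy by simp
  next
    case False
    then show ?thesis using d[of i] that by (auto simp: tree_points_def)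
  qed
  have nth: "map g [0..<Suc k] ! i = g i" if "i \<le> k" for i
    using that by (simp del: upt_Suc)
  have "simple_path_between V E x y (map g [0..<Suc k]) (map d [0..<k])"
    unfolding simple_path_between_def
  proof (intro conjI)
    show "hd (map g [0..<Suc k]) = x" by (simp add: g hd_map del: upt_Suc)
    show "last (map g [0..<Suc k]) = y" by (simp add: g)
    show "set (map g [0..<Suc k]) \<subseteq> tree_points V E" using points by auto
  qed (use d distinct disjoint in \<open>auto simp: nth simp del: upt_Suc\<close>)
  then show ?thesis by blast
qed

lemma tree_dist_cuts:
  assumes h: "\<And>e. e \<in> E \<Longrightarrow> h e \<in> e"
    and xy: "x \<in> tree_points V E" "y \<in> tree_points V E"
  shows "tree_dist V E w x y =
    (\<Sum>e\<in>E. w e * \<bar>sum y (branch E e (h e)) - sum x (branch E e (h e))\<bar>)"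
  unfolding tree_dist_def
proof (rule the_equality)
  show "\<exists>ps es. simple_path_between V E x y ps es \<and>
      (\<Sum>e\<in>E. w e * \<bar>sum y (branch E e (h e)) - sum x (branch E e (h e))\<bar>) = path_length w ps es"
    using simple_path_exists[OF xy] path_length_cuts[OF h] by metis
next
  fix l assume "\<exists>ps es. simple_path_between V E x y ps es \<and> l = path_length w ps es"
  then obtain ps es where "simple_path_between V E x y ps es" "l = path_length w ps es"
    by (elim exE conjE)
  then show "l = (\<Sum>e\<in>E. w e * \<bar>sum y (branch E e (h e)) - sum x (branch E e (h e))\<bar>)"
    using path_length_cuts[OF h] by simp
qed

section \<open>Construction of the embedding\<close>

text \<open>Two edges share no interior points: a point with some mass on the smaller branch is either on
  \<open>f\<close> or behind it, and in both cases it has passed \<open>e\<close> completely.\<close>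

lemma point_cut_nested:
  assumes e: "e \<in> E" "v \<in> e" and f: "f \<in> E" "u \<in> f" and "e \<noteq> f"
    and sub: "branch E f u \<subseteq> branch E e v"
    and p: "p \<in> tree_points V E" "0 < sum p (branch E f u)"
  shows "sum p (branch E e v) = 1"
proof -
  obtain s where s: "p \<in> cell s" "s \<in> E \<or> (\<exists>z. s = {z})"
    using p(1) by (auto simp: tree_points_def)
  have "s \<inter> branch E f u \<noteq> {}"
    using sum_cell_disjoint[OF s(1) finite_branch[OF f]] p(2) by force
  then have meets: "s \<inter> branch E e v \<noteq> {}" using sub by blast
  have "s \<subseteq> branch E e v"
  proof (cases "s = e")
    case True
    have "e \<subseteq> branch E f u \<or> e \<inter> branch E f u = {}"
      using edge_in_branch e \<open>e \<noteq> f\<close> by blast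
    then show ?thesis using \<open>s \<inter> branch E f u \<noteq> {}\<close> True sub by blast
  next
    case False
    then show ?thesis using s(2) meets edge_in_branch[of s e v] by blast
  qed
  then show ?thesis using sum_cell_superset[OF s(1) finite_branch[OF e]] by simp
qed

lemma point_cut_bounds:
  assumes "e \<in> E" "v \<in> e" "p \<in> tree_points V E"
  shows "0 \<le> sum p (branch E e v)" "sum p (branch E e v) \<le> 1"
proof -
  obtain s where s: "p \<in> cell s" "finite s"
    using assms(3) edge_finite by (auto simp: tree_points_def)
  show "0 \<le> sum p (branch E e v)" using s(1) by (intro sum_nonneg) (auto simp: cell_def)
  show "sum p (branch E e v) \<le> 1" using sum_cell_le_1 s finite_branch assms by blast
qed

text \<open>The smaller coordinate can be positive only after the larger one has reached 1. Hence the
  pair of coordinates stays on two adjacent sides of the unit square, and neither coordinate can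
  rise from one point to another while the other one falls.\<close>

lemma nested_cuts_same_direction:
  assumes e: "e \<in> E" "v \<in> e" and f: "f \<in> E" "u \<in> f" and "e \<noteq> f"
    and sub: "branch E f u \<subseteq> branch E e v"
    and p: "p \<in> tree_points V E" and q: "q \<in> tree_points V E"
  shows "0 \<le> (sum q (branch E e v) - sum p (branch E e v)) *
             (sum q (branch E f u) - sum p (branch E f u))"
proof -
  have one: "sum r (branch E f u) = 0 \<or> sum r (branch E e v) = 1"
    if "r \<in> tree_points V E" for r
    using point_cut_nested[OF e f \<open>e \<noteq> f\<close> sub that] point_cut_bounds[OF f that] by force
  show ?thesis
    using one[OF p] one[OF q] point_cut_bounds[OF e p] point_cut_bounds[OF e q]
      point_cut_bounds[OF f p] point_cut_bounds[OF f q]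
    by (auto simp: zero_le_mult_iff)
qed

text \<open>Two edges on the path from \<open>a\<close> to \<open>b\<close>: their branches towards \<open>b\<close> share \<open>b\<close> and both miss
  \<open>a\<close>, so compatibility leaves only the possibility that they are nested.\<close>

lemma cuts_same_direction:
  assumes e: "e \<in> E" "v \<in> e" and f: "f \<in> E" "u \<in> f"
    and b: "b \<in> branch E e v" "b \<in> branch E f u"
    and a: "a \<in> V" "a \<notin> branch E e v" "a \<notin> branch E f u"
    and p: "p \<in> tree_points V E" and q: "q \<in> tree_points V E"
  shows "0 \<le> (sum q (branch E e v) - sum p (branch E e v)) *
             (sum q (branch E f u) - sum p (branch E f u))"
proof (cases "e = f")
  case True
  have "u = v"
  proof (rule ccontr)
    assume "u \<noteq> v"
    then have "e = {u, v}" using edge_obtain[OF e] f(2) True by (metis insertE singletonD)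
    then have "branch E e u = V - branch E e v" using other_branch[OF e(1)] \<open>u \<noteq> v\<close> by blast
    then show False using b True by blast
  qed
  then show ?thesis using True by simp
next
  case False
  have "b \<in> V" using b branch_subset e edge_subset by blast
  then have "branch E f u \<subseteq> branch E e v \<or> branch E e v \<subseteq> branch E f u"
    using branch_compatible[OF e f] a b branch_subset e f edge_subset
    unfolding compatible_on_def by blast
  then show ?thesis
    using nested_cuts_same_direction[OF e f False _ p q] nested_cuts_same_direction[OF f e _ _ p q]
      False by (metis mult.commute)
qed

text \<open>The paths from \<open>a i\<close> to \<open>b i\<close> cover the tree; \<open>v\<close> is the end of \<open>e\<close> that points towards
  \<open>b i\<close>. The pairing lemma is applied with an arbitrary choice of one end for each edge, as
  separation does not depend on that choice.\<close>

lemma leaf_pairs_separate_edges: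
  assumes "card (leaves V E) \<le> 2 * CARD('n::finite)"
  shows "\<exists>(a :: 'n \<Rightarrow> 'a) b. \<forall>e\<in>E. \<exists>i. \<exists>v\<in>e. a i \<in> V - branch E e v \<and> b i \<in> branch E e v"
proof -
  have leaves: "leaves V E \<subseteq> V" by (auto simp: leaves_def)
  define h where "h e = (SOME v. v \<in> e)" for e :: "'a set"
  have h: "h e \<in> e" if "e \<in> E" for e
  proof -
    have "e \<noteq> {}" using edge_card[OF that] by auto
    then show ?thesis unfolding h_def by (rule some_in_eq[THEN iffD2])
  qed
  have "\<exists>(a :: 'n \<Rightarrow> 'a) b. \<forall>e\<in>E. \<exists>i. a i \<in> leaves V E \<and> b i \<in> leaves V E \<and>
      (a i \<in> branch E e (h e)) \<noteq> (b i \<in> branch E e (h e))"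
  proof (rule pairing_crossing_all_cuts[OF finite_E _ assms])
    show "finite (leaves V E)" using leaves finite_V finite_subset by blast
  next
    fix e f assume "e \<in> E" "f \<in> E"
    then show "compatible_on (leaves V E) (branch E e (h e)) (branch E f (h f))"
      using branch_compatible[of e "h e" f "h f"] h leaves unfolding compatible_on_def by blast
  next
    fix e assume e: "e \<in> E"
    obtain u where u: "e = {u, h e}" "u \<noteq> h e" using edge_obtain h e by blast
    have "leaves V E \<inter> branch E e u \<noteq> {}" using branch_contains_leaf e u by blast
    then show "leaves V E \<inter> branch E e (h e) \<noteq> {} \<and> leaves V E - branch E e (h e) \<noteq> {}"
      using branch_contains_leaf[OF e h[OF e]] other_branch[OF e u] by blast
  qed
  then obtain a b :: "'n \<Rightarrow> 'a" where ab: "\<forall>e\<in>E. \<exists>i. a i \<in> leaves V E \<and> b i \<in> leaves V E \<and>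
      (a i \<in> branch E e (h e)) \<noteq> (b i \<in> branch E e (h e))"
    by (elim exE)
  have "\<exists>i. \<exists>v\<in>e. a i \<in> V - branch E e v \<and> b i \<in> branch E e v" if e: "e \<in> E" for e
  proof -
    obtain u where u: "e = {u, h e}" "u \<noteq> h e" using edge_obtain h e by blast
    obtain i where i: "a i \<in> V" "b i \<in> V"
      "(a i \<in> branch E e (h e)) \<noteq> (b i \<in> branch E e (h e))"
      using ab e leaves by blast
    have "u \<in> e" using u by blast
    moreover have "branch E e u = V - branch E e (h e)" using other_branch[OF e u] .
    ultimately show ?thesis using i h[OF e] by blast
  qed
  then show ?thesis by blast
qed

end

theorem theorem4p6:
  fixes V :: "'a set" and E :: "'a set set" and w :: "'a set \<Rightarrow> real"
  assumes "metric_tree_data V E w"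
    and "card (leaves V E) \<le> 2 * CARD('n::finite)"
  shows "\<exists>f :: ('a \<Rightarrow> real) \<Rightarrow> real ^ 'n.
           isometric_embedding (tree_points V E) (tree_dist V E w) d1 f"
proof -
  interpret tree V E
    using assms(1) by unfold_locales (simp add: metric_tree_data_def)
  have w: "0 < w e" if "e \<in> E" for e using assms(1) that by (simp add: metric_tree_data_def)
  obtain a b :: "'n \<Rightarrow> 'a" where
    "\<forall>e\<in>E. \<exists>i. \<exists>v\<in>e. a i \<in> V - branch E e v \<and> b i \<in> branch E e v"
    using leaf_pairs_separate_edges[OF assms(2)] by blast
  \<comment> \<open>\<open>r e\<close> is the axis that carries \<open>e\<close>, and \<open>h e\<close> the end of \<open>e\<close> in the positive direction.\<close>
  then obtain r h where rh: "\<And>e. e \<in> E \<Longrightarrow> h e \<in> e \<and> a (r e) \<in> V - branch E e (h e)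
      \<and> b (r e) \<in> branch E e (h e)"
    by metis
  define c where "c e p = sum p (branch E e (h e))" for e and p :: "'a \<Rightarrow> real"
  define f :: "('a \<Rightarrow> real) \<Rightarrow> real ^ 'n" where
    "f p = (\<chi> i. \<Sum>e\<in>{e\<in>E. r e = i}. w e * c e p)" for p
  have "d1 (f x) (f y) = tree_dist V E w x y"
    if xy: "x \<in> tree_points V E" "y \<in> tree_points V E" for x y
  proof -
    have coord: "\<bar>f x $ i - f y $ i\<bar> = (\<Sum>e\<in>{e\<in>E. r e = i}. w e * \<bar>c e y - c e x\<bar>)" for i
    proof -
      have "\<bar>f x $ i - f y $ i\<bar> = \<bar>\<Sum>e\<in>{e\<in>E. r e = i}. w e * (c e y - c e x)\<bar>"
        by (simp add: f_def sum_subtractf right_diff_distrib abs_minus_commute)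
      also have "\<dots> = (\<Sum>e\<in>{e\<in>E. r e = i}. \<bar>w e * (c e y - c e x)\<bar>)"
      proof (rule abs_sum_same_sign)
        fix e e' assume "e \<in> {e\<in>E. r e = i}" "e' \<in> {e\<in>E. r e = i}"
        then have e: "e \<in> E" "r e = i" and e': "e' \<in> E" "r e' = i" by auto
        have "0 \<le> (c e y - c e x) * (c e' y - c e' x)"
          unfolding c_def
          by (rule cuts_same_direction[where a = "a i" and b = "b i"])
             (use rh[of e] rh[of e'] e e' xy in auto)
        moreover have "0 < w e * w e'" using w e e' by simp
        ultimately have "0 \<le> (w e * w e') * ((c e y - c e x) * (c e' y - c e' x))" by simp
        then show "0 \<le> w e * (c e y - c e x) * (w e' * (c e' y - c e' x))"
          by (simp add: algebra_simps)
      qed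
      also have "\<dots> = (\<Sum>e\<in>{e\<in>E. r e = i}. w e * \<bar>c e y - c e x\<bar>)"
        by (rule sum.cong) (use w in \<open>auto simp: abs_mult less_imp_le\<close>)
      finally show ?thesis .
    qed
    have "d1 (f x) (f y) = (\<Sum>i\<in>UNIV. \<Sum>e\<in>{e\<in>E. r e = i}. w e * \<bar>c e y - c e x\<bar>)"
      by (simp add: d1_def coord)
    also have "\<dots> = (\<Sum>e\<in>E. w e * \<bar>c e y - c e x\<bar>)"
      by (rule sum.group) (use finite_E in auto)
    also have "\<dots> = tree_dist V E w x y"
      using tree_dist_cuts[of h, OF _ xy] rh by (simp add: c_def)
    finally show ?thesis .
  qed
  then show ?thesis by (intro exI[of _ f]) (simp add: isometric_embedding_def)
qed

end
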